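(* Folland's fundamental solution on the Heisenberg group $\mathbb{H}^{n}$, $$G_{0}^{F}(z,\tau)=c_{n}\left(|z|^{4}+\tau^{2}\right)^{-\frac{n}{2}},\qquad (z,\tau)\in\mathbb{H}^{n},\qquad c_{n}=\frac{2^{n}\,\Gamma^{2}\left(\frac{n}{2}\right)}{\pi^{n+1}},$$ can also be expressed as $$G_{0}^{F}(z,\tau)=\frac{2^{n+1}\,\Gamma\left(\frac{n}{2}\right)}{\pi^{n+1}}\int_{0}^{+\infty}x^{n-1}e^{-x|z|^{2}}\,\Psi\left(\frac{n}{2},n;2x|z|^{2}\right)\cos(\tau x)\,dx$$ in terms of the Tricomi $\Psi$-function.
   Context: The Heisenberg group $\mathbb{H}^{n}$ is the nilpotent Lie group with underlying manifold $\mathbb{C}^{n}\times\mathbb{R}$, coordinates $(z,\tau)=(z_1,\dots,z_n;\tau)$ and group law $(z,\tau).(w,s)=(z+w,\tau+s+2\,\mathrm{Im}\langle z,w\rangle)$, where $\langle z,w\rangle=\sum_{j=1}^{n}z_j\overline{w_j}$; $|z|^{2}=\langle z,z\rangle$. The function $G_{0}^{F}$ is defined by the explicit formula given first in the claim; it is called Folland's fundamental solution (with source at zero) of the sub-Laplacian on $\mathbb{H}^{n}$. $\Gamma$ is the Euler Gamma function. $\Psi(a,c;u)$ is the Tricomi confluent hypergeometric function (also denoted $U(a,c,u)$), which for $a>0$ and $u>0$ satisfies $$\Gamma(a)\,\Psi(a,c;u)=\int_{0}^{+\infty}e^{-at}\exp\left(-\frac{u}{e^{t}-1}\right)\left(1-e^{-t}\right)^{-c}dt.$$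 *)

theory Defs
  imports "HOL-Analysis.Analysis"
begin

text \<open>
  The underlying manifold \<open>\<complex>\<^sup>n \<times> \<real>\<close> of the Heisenberg group, with \<open>n = CARD('n)\<close>. The group law does
  not enter into the formulas below. The norm of \<^typ>\<open>complex ^ 'n\<close> is the Hermitian one,
  \<open>(norm z)\<^sup>2 = (\<Sum>j\<in>UNIV. (cmod (z $ j))\<^sup>2)\<close>.
\<close>

type_synonym 'n heisenberg = "(complex ^ 'n) \<times> real"

definition folland_const :: "nat \<Rightarrow> real" where
  "folland_const n = 2 ^ n * (Gamma (real n / 2))\<^sup>2 / pi ^ (n + 1)"

definition folland_G0 :: "'n::finite heisenberg \<Rightarrow> real" where
  "folland_G0 = (\<lambda>(z, \<tau>).
     folland_const CARD('n) * (norm z ^ 4 + \<tau>\<^sup>2) powr (- (real CARD('n) / 2)))"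

text \<open>
  The Tricomi confluent hypergeometric function \<open>\<Psi>(a,c;u) = U(a,c,u)\<close>, given for real \<open>a > 0\<close> and
  \<open>u > 0\<close> by its Laplace integral (Erdelyi et al., Higher Transcendental Functions I, 6.5 (2)).
  Outside this range the value is meaningless.
\<close>

definition tricomi_Psi :: "real \<Rightarrow> real \<Rightarrow> real \<Rightarrow> real" where
  "tricomi_Psi a c u =
     (LBINT s:{0<..}. exp (- (u * s)) * s powr (a - 1) * (1 + s) powr (c - a - 1)) / Gamma a"

lemma LBINT_eq_HK:
  fixes f :: "real \<Rightarrow> real"
  assumes "set_borel_measurable borel S f"
  shows "(LBINT x:S. f x) = (if f absolutely_integrable_on S then integral S f else 0)"
proof -
  have eq: "(LBINT x:S. f x) = (LINT x:S|lebesgue. f x)"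
    using assms unfolding set_lebesgue_integral_def set_borel_measurable_def
    by (subst integral_completion) auto
  show ?thesis
  proof (cases "f absolutely_integrable_on S")
    case True
    then show ?thesis
      using eq set_lebesgue_integral_eq_integral(2)[OF True] by simp
  next
    case False
    then show ?thesis
      using eq unfolding set_lebesgue_integral_def set_integrable_def
      by (simp add: not_integrable_integral_eq)
  qed
qed

text \<open>The substitution \<open>s = 1 / (exp t - 1)\<close> gives the form of the integral used for \<open>\<Psi>\<close> here:\<close>

lemma tricomi_Psi_integral:
  fixes a c u :: real
  assumes "a > 0" "u > 0"
  shows "Gamma a * tricomi_Psi a c u =
    (LBINT t:{0<..}. exp (- (a * t)) * exp (- (u / (exp t - 1))) * (1 - exp (- t)) powr (- c))"
proof -
  define f where "f = (\<lambda>s. exp (- (u * s)) * s powr (a - 1) * (1 + s) powr (c - a - 1))"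
  define h where "h = (\<lambda>t. exp (- (a * t)) * exp (- (u / (exp t - 1))) * (1 - exp (- t)) powr (- c))"
  define g where "g = (\<lambda>t::real. 1 / (exp t - 1))"
  define g' where "g' = (\<lambda>t::real. - exp t / (exp t - 1)\<^sup>2)"
  have img: "g ` {0<..} = {0<..}"
  proof (intro equalityI subsetI)
    fix y assume "y \<in> g ` {0<..}"
    then show "y \<in> {0<..}" by (auto simp: g_def)
  next
    fix y :: real assume "y \<in> {0<..}"
    then have y: "y > 0" by simp
    have "y = g (ln (1 + 1 / y))" "ln (1 + 1 / y) > 0"
      using y by (auto simp: g_def add_pos_pos intro!: ln_gt_zero)
    then show "y \<in> g ` {0<..}" by auto
  qed
  have inj: "inj_on g {0<..}"
    by (auto simp: inj_on_def g_def)
  have der: "(g has_field_derivative g' t) (at t within {0<..})" if "t \<in> {0<..}" for t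
    using that unfolding g_def g'_def
    by (auto intro!: derivative_eq_intros simp: power2_eq_square)
  have sub: "\<bar>g' t\<bar> * f (g t) = h t" if "t > 0" for t
  proof -
    define E where "E = exp t - 1"
    have E: "E > 0" and Et: "exp t = 1 + E" using that by (auto simp: E_def)
    have t: "t = ln (1 + E)" using Et by (metis ln_exp)
    have m: "1 - exp (- t) = E / (1 + E)"
      using E by (simp add: exp_minus Et field_simps)
    have ea: "exp (- (a * t)) = (1 + E) powr (- a)"
      using E by (simp add: powr_def t)
    have "\<bar>g' t\<bar> * f (g t) = (1 + E) / E\<^sup>2 * (exp (- (u / E)) * (1 / E) powr (a - 1) * ((1 + E) / E) powr (c - a - 1))"
    proof -
      have "\<bar>g' t\<bar> = (1 + E) / E\<^sup>2"
        using E by (simp add: g'_def Et abs_divide)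
      moreover have "1 + g t = (1 + E) / E" "g t = 1 / E"
        using E by (auto simp: g_def Et field_simps)
      ultimately show ?thesis by (simp add: f_def)
    qed
    also have "\<dots> = exp (- (u / E)) * ((1 + E) powr 1 * (1 + E) powr (c - a - 1)) *
        (E powr (- 2) * E powr (- (a - 1)) * E powr (- (c - a - 1)))"
    proof -
      have "(1 / E) powr (a - 1) = E powr (- (a - 1))"
        using E by (simp only: powr_minus powr_divide) (simp add: inverse_eq_divide)
      moreover have "((1 + E) / E) powr (c - a - 1) = (1 + E) powr (c - a - 1) * E powr (- (c - a - 1))"
        using E by (simp only: powr_minus powr_divide) (simp add: powr_divide divide_inverse)
      moreover have "(1 + E) / E\<^sup>2 = (1 + E) powr 1 * E powr (- 2)"
        using E by (simp add: powr_minus divide_inverse)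
      ultimately show ?thesis by (simp only: mult_ac)
    qed
    also have "\<dots> = exp (- (u / E)) * (1 + E) powr (c - a) * E powr (- c)"
      by (simp only: powr_add [symmetric]) (simp add: algebra_simps)
    also have "\<dots> = h t"
      using E unfolding h_def ea m E_def [symmetric]
      by (simp add: powr_divide powr_minus powr_diff divide_simps)
    finally show ?thesis .
  qed
  have "((\<lambda>x. \<bar>g' x\<bar> * f (g x)) absolutely_integrable_on {0<..} \<and>
           integral {0<..} (\<lambda>x. \<bar>g' x\<bar> * f (g x)) = b)
     \<longleftrightarrow> (f absolutely_integrable_on {0<..} \<and> integral {0<..} f = b)" for b
    using has_absolute_integral_change_of_variables_1' [OF _ der inj, of f b]
    by (simp add: img)
  moreover have "(\<lambda>x. \<bar>g' x\<bar> * f (g x)) absolutely_integrable_on {0<..} \<longleftrightarrow>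
      h absolutely_integrable_on {0<..}"
    unfolding set_integrable_def by (intro Bochner_Integration.integrable_cong) (auto simp: sub indicator_def)
  moreover have "integral {0<..} (\<lambda>x. \<bar>g' x\<bar> * f (g x)) = integral {0<..} h"
    by (intro Henstock_Kurzweil_Integration.integral_cong) (auto simp: sub)
  ultimately have iff: "(h absolutely_integrable_on {0<..} \<and> integral {0<..} h = b)
     \<longleftrightarrow> (f absolutely_integrable_on {0<..} \<and> integral {0<..} f = b)" for b
    by simp
  have "set_borel_measurable borel {0<..} f" "set_borel_measurable borel {0<..} h"
    unfolding f_def h_def set_borel_measurable_def by measurable
  then have "(LBINT s:{0<..}. f s) = (LBINT t:{0<..}. h t)"
    using iff by (auto simp: LBINT_eq_HK)
  moreover have "Gamma a \<noteq> 0"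
    using Gamma_real_pos [OF assms(1)] by simp
  ultimately show ?thesis
    unfolding tricomi_Psi_def f_def h_def by simp
qed

end

theory Submission
  imports Defs
begin

text \<open>
  Write \<open>n = m + 1\<close> for the dimension, \<open>a = n / 2\<close>, \<open>r = |z|\<^sup>2\<close> and \<open>\<rho> = sqrt (r\<^sup>2 + \<tau>\<^sup>2)\<close>. Since the second
  parameter of \<open>\<Psi>\<close> is twice the first, the two powers in its Laplace integral have the same
  exponent, so that
  \<open>\<Gamma>(a) \<Psi>(a, n; 2xr) = \<integral> exp (- 2xrs) (s (1 + s)) powr (a - 1) ds\<close>. The factor
  \<open>exp (- xr)\<close> combines with it to \<open>exp (- xr (1 + 2s))\<close>. After exchanging the order of
  integration (\<open>tricomi_laplace_Fubini\<close>), the \<open>x\<close>-integral is an elementary Laplace transform, the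
  real part of \<open>m! (r (1 + 2s) - i\<tau>)\<^sup>-\<^sup>n\<close> (\<open>integral_power_times_exp_cos\<close>).

  The substitution \<open>1 + 2s = 1 / sin \<theta>\<close> turns the remaining \<open>s\<close>-integral into
  \<open>2\<^sup>-\<^sup>m \<integral> cos\<^sup>m \<theta> Re (r - i\<tau> sin \<theta>)\<^sup>-\<^sup>n d\<theta>\<close> over a quarter period
  (\<open>tricomi_kernel_substitution\<close>). In polar coordinates \<open>r = \<rho> cos \<phi>\<close>, \<open>\<tau> = \<rho> sin \<phi>\<close> a factor
  \<open>\<rho>\<^sup>-\<^sup>n = (|z|\<^sup>4 + \<tau>\<^sup>2) powr (- n / 2)\<close> comes out, and what is left depends on \<open>\<phi>\<close> alone. The heart
  of the proof is that it does not even depend on \<open>\<phi>\<close> (\<open>rotation_invariant_integral\<close>). At \<open>\<phi> = 0\<close>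
  it is the Wallis integral of \<open>cos\<^sup>m\<close>, a Beta value, and by Legendre duplication its
  product with \<open>m!\<close> is \<open>2\<^sup>m \<Gamma>(n / 2)\<^sup>2 / 2\<close> (\<open>Gamma_times_integral_cos_power\<close>).
\<close>

section \<open>The Laplace transform of a power\<close>

text \<open>
  In absolute value the integrand is the one of \<open>\<Gamma>(m + 1)\<close>, rescaled by the real part of \<open>w\<close>.
\<close>

lemma set_integrable_power_times_cexp:
  fixes w :: complex
  assumes "Re w > 0"
  shows "set_integrable lborel {0<..} (\<lambda>x. of_real x ^ m * exp (- w * of_real x))"
proof -
  let ?f = "\<lambda>x. of_real x ^ m * exp (- w * complex_of_real x)"
  have "(\<lambda>x. complex_of_real x powr (of_nat (Suc m) - 1) / of_real (exp (Re w * x)))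
          absolutely_integrable_on {0<..}"
    using assms by (intro absolutely_integrable_Gamma_integral) auto
  then have "set_integrable lebesgue {0<..} ?f"
  proof (rule set_integrable_bound)
    show "set_borel_measurable lebesgue {0<..} ?f"
      unfolding set_borel_measurable_def by (intro measurable_completion) simp
    show "AE x in lebesgue. x \<in> {0<..} \<longrightarrow>
        norm (?f x) \<le> norm (complex_of_real x powr (of_nat (Suc m) - 1) / of_real (exp (Re w * x)))"
      by (auto simp: norm_mult norm_power powr_of_real powr_realpow exp_minus divide_inverse
          norm_powr_real_powr norm_inverse simp flip: powr_realpow intro!: AE_I2)
  qed
  then show ?thesis
    unfolding set_integrable_def by (subst (asm) integrable_completion) auto
qed

lemma tendsto_power_times_cexp_at_top:
  fixes w :: complex
  assumes "Re w > 0"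
  shows "((\<lambda>x. of_real x ^ m * exp (- w * of_real x)) \<longlongrightarrow> 0) at_top"
proof (rule tendsto_norm_zero_cancel)
  have "((\<lambda>x. (Re w * x) ^ m / exp (Re w * x)) \<longlongrightarrow> 0) at_top"
    using assms by (intro filterlim_compose[OF tendsto_power_div_exp_0] filterlim_tendsto_pos_mult_at_top[OF tendsto_const] filterlim_ident)
  from tendsto_mult_right[OF this, of "inverse (Re w ^ m)"]
  have "((\<lambda>x. x ^ m * exp (- (Re w * x))) \<longlongrightarrow> 0) at_top"
    using assms by (simp add: power_mult_distrib exp_minus field_simps)
  then show "((\<lambda>x. norm (of_real x ^ m * exp (- w * of_real x))) \<longlongrightarrow> 0) at_top"
    by (rule Lim_transform_eventually)
       (use eventually_ge_at_top[of 0] in eventually_elim, simp add: norm_mult norm_power)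
qed

text \<open>
  For complex \<open>w\<close> this is not a rescaling of the Gamma integral. Instead, the derivative of
  \<open>x ^ (m + 1) * exp (- w * x)\<close> has integral \<open>0\<close>, which gives the recursion
  \<open>w * L (m + 1) = (m + 1) * L m\<close> for the transforms.
\<close>

lemma laplace_transform_power:
  fixes w :: complex
  assumes "Re w > 0"
  shows "(LBINT x:{0<..}. of_real x ^ m * exp (- w * of_real x)) = fact m / w ^ Suc m"
proof -
  define L where "L = (\<lambda>m. LBINT x:{0<..}. of_real x ^ m * exp (- w * complex_of_real x))"
  have w: "w \<noteq> 0" using assms by auto
  have ei: "einterval 0 \<infinity> = {0<..}"
    by (auto simp: einterval_def zero_ereal_def)
  have FTC: "(LBINT x:{0<..}. f x) = - F 0"
    if F: "\<And>x. (F has_vector_derivative f x) (at x)" and f: "continuous_on UNIV f"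
      and i: "set_integrable lborel {0<..} f" and lim: "(F \<longlongrightarrow> 0) at_top"
    for F f :: "real \<Rightarrow> complex"
  proof -
    have "(LBINT x=0..\<infinity>. f x) = 0 - F 0"
    proof (rule interval_integral_FTC_integrable[where F = F])
      have "isCont F 0"
        using F[of 0] has_vector_derivative_continuous by blast
      then show "((F \<circ> real_of_ereal) \<longlongrightarrow> F 0) (at_right 0)"
        by (simp add: zero_ereal_def ereal_tendsto_simps continuous_within filterlim_at_split)
      show "((F \<circ> real_of_ereal) \<longlongrightarrow> 0) (at_left \<infinity>)"
        using lim by (simp add: ereal_tendsto_simps)
      show "isCont f x" for x
        using f by (simp add: continuous_on_eq_continuous_at)
    qed (use F i ei in auto)
    then show ?thesis
      by (simp add: interval_lebesgue_integral_def ei)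
  qed
  have "L m = fact m / w ^ Suc m" for m
  proof (induction m)
    case 0
    have "L 0 = - (- exp (- w * complex_of_real 0) / w)"
      unfolding L_def
    proof (rule FTC)
      show "((\<lambda>x. - exp (- w * complex_of_real x) / w) has_vector_derivative
              of_real x ^ 0 * exp (- w * of_real x)) (at x)" for x
        by (rule has_vector_derivative_real_field)
           (use w in \<open>auto intro!: derivative_eq_intros\<close>)
      show "((\<lambda>x. - exp (- w * complex_of_real x) / w) \<longlongrightarrow> 0) at_top"
        using tendsto_divide[OF tendsto_minus[OF tendsto_power_times_cexp_at_top[OF assms, of 0]] tendsto_const[of w]] w by simp
      show "continuous_on UNIV (\<lambda>x. complex_of_real x ^ 0 * exp (- w * of_real x))"
        by (intro continuous_intros)
    qed (use set_integrable_power_times_cexp[OF assms, of 0] in simp)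
    then show ?case by simp
  next
    case (Suc m)
    let ?f = "\<lambda>m x. complex_of_real x ^ m * exp (- w * complex_of_real x)"
    have i: "set_integrable lborel {0<..} (?f k)" for k
      by (rule set_integrable_power_times_cexp[OF assms])
    have "(LBINT x:{0<..}. of_nat (Suc m) * ?f m x - w * ?f (Suc m) x) = - ?f (Suc m) 0"
    proof (rule FTC)
      show "(?f (Suc m) has_vector_derivative of_nat (Suc m) * ?f m x - w * ?f (Suc m) x) (at x)" for x
        by (rule has_vector_derivative_real_field)
           (auto intro!: derivative_eq_intros simp: algebra_simps simp del: power_Suc)
      show "(?f (Suc m) \<longlongrightarrow> 0) at_top"
        by (rule tendsto_power_times_cexp_at_top[OF assms])
      show "continuous_on UNIV (\<lambda>x. of_nat (Suc m) * ?f m x - w * ?f (Suc m) x)"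
        by (intro continuous_intros)
    qed (intro set_integral_diff set_integrable_mult_right i)
    also have "(LBINT x:{0<..}. of_nat (Suc m) * ?f m x - w * ?f (Suc m) x) =
        of_nat (Suc m) * L m - w * L (Suc m)"
      unfolding L_def
      by (simp only: set_integral_diff(2) set_integrable_mult_right i set_integral_mult_right)
    finally show ?case
      using w Suc.IH by (simp add: field_simps)
  qed
  then show ?thesis by (simp add: L_def)
qed

text \<open>
  The real part of \<open>laplace_transform_power\<close> at \<open>w = b - it\<close>.
\<close>

lemma integral_power_times_exp_cos:
  fixes b t :: real
  assumes "b > 0"
  shows "set_integrable lborel {0<..} (\<lambda>x. x ^ m * exp (- (b * x)) * cos (t * x))"
    and "(LBINT x:{0<..}. x ^ m * exp (- (b * x)) * cos (t * x)) =
           fact m * Re (1 / (of_real b - \<i> * of_real t) ^ Suc m)"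
proof -
  let ?w = "of_real b - \<i> * of_real t"
  let ?f = "\<lambda>x. complex_of_real x ^ m * exp (- ?w * of_real x)"
  have w: "Re ?w > 0" using assms by simp
  have Re: "Re (?f x) = x ^ m * exp (- (b * x)) * cos (t * x)" for x
    by (simp add: Re_exp mult_ac flip: of_real_power)
  note i = set_integrable_power_times_cexp[OF w, of m]
  show "set_integrable lborel {0<..} (\<lambda>x. x ^ m * exp (- (b * x)) * cos (t * x))"
    using integrable_Re[OF i[unfolded set_integrable_def]]
    unfolding set_integrable_def scaleR_complex.sel Re real_scaleR_def .
  have "(LBINT x:{0<..}. Re (?f x)) = Re (LBINT x:{0<..}. ?f x)"
    using i unfolding set_lebesgue_integral_def set_integrable_def
    by (subst integral_Re [symmetric]) auto
  also have "\<dots> = Re (of_real (fact m) * (1 / ?w ^ Suc m))"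
    by (subst laplace_transform_power[OF w]) simp
  finally show "(LBINT x:{0<..}. x ^ m * exp (- (b * x)) * cos (t * x)) =
           fact m * Re (1 / (of_real b - \<i> * of_real t) ^ Suc m)"
    unfolding Re by (simp only: Re_complex_of_real Im_complex_of_real times_complex.sel mult_zero_left diff_0_right)
qed

section \<open>From the half-line to a quarter period\<close>

text \<open>
  With \<open>s = (1 / sin \<theta> - 1) / 2\<close> one has \<open>s (1 + s) = (cos \<theta> / (2 sin \<theta>))\<^sup>2\<close>, so every power of
  \<open>sin \<theta>\<close> cancels: \<open>sin\<^sup>-\<^sup>2 \<theta>\<close> comes from the Jacobian, \<open>sin \<theta> powr (1 - m)\<close> from the weight and
  \<open>sin\<^sup>m\<^sup>+\<^sup>1 \<theta>\<close> from the kernel. The new integrand is continuous on a compact interval, which also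
  shows that the original one is integrable.
\<close>

lemma tricomi_kernel_substitution:
  fixes r t :: real and m :: nat
  assumes "r > 0"
  defines "h \<equiv> \<lambda>s. (s * (1 + s)) powr (real (Suc m) / 2 - 1) *
             Re (1 / (of_real (r * (1 + 2 * s)) - \<i> * of_real t) ^ Suc m)"
    and "k \<equiv> \<lambda>\<theta>. cos \<theta> ^ m * Re (1 / (of_real r - \<i> * of_real (t * sin \<theta>)) ^ Suc m)"
  shows "set_integrable lborel {0<..} h"
    and "(LBINT s:{0<..}. h s) = integral {0..pi/2} k / 2 ^ m"
proof -
  define g where "g = (\<lambda>\<theta>::real. (1 / sin \<theta> - 1) / 2)"
  define g' where "g' = (\<lambda>\<theta>::real. - (cos \<theta> / (2 * (sin \<theta>)\<^sup>2)))"
  let ?S = "{0<..<pi/2::real}"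
  have sc: "sin \<theta> > 0" "cos \<theta> > 0" if "\<theta> \<in> ?S" for \<theta> :: real
    using that by (auto intro!: sin_gt_zero cos_gt_zero)
  have img: "g ` ?S = {0<..}"
  proof (intro equalityI subsetI)
    fix y assume "y \<in> g ` ?S"
    then obtain \<theta> where t: "\<theta> \<in> ?S" "y = g \<theta>" by auto
    have "sin \<theta> < sin (pi/2)"
      using t(1) by (intro sin_monotone_2pi) auto
    then have "1 < 1 / sin \<theta>" using sc[OF t(1)] by simp
    then show "y \<in> {0<..}" using t(2) by (simp add: g_def)
  next
    fix y :: real assume "y \<in> {0<..}"
    then have y: "y > 0" by simp
    define x where "x = 1 / (1 + 2 * y)"
    have "0 < x" "x < 1" using y by (auto simp: x_def)
    then have "arcsin x < arcsin 1" "arcsin 0 < arcsin x"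
      by (subst arcsin_less_mono; auto)+
    moreover have "g (arcsin x) = y"
      using \<open>0 < x\<close> \<open>x < 1\<close> by (simp add: g_def) (simp add: x_def)
    ultimately show "y \<in> g ` ?S" by (intro image_eqI[of _ _ "arcsin x"]) auto
  qed
  have inj: "inj_on g ?S"
  proof (rule inj_onI)
    fix x y assume xy: "x \<in> ?S" "y \<in> ?S" "g x = g y"
    then have "sin x = sin y"
      using sc[OF xy(1)] sc[OF xy(2)] by (simp add: g_def)
    then show "x = y" using xy sin_inj_pi[of x y] by auto
  qed
  have der: "(g has_field_derivative g' \<theta>) (at \<theta> within ?S)" if "\<theta> \<in> ?S" for \<theta>
    unfolding g_def g'_def using sc[OF that]
    by (auto intro!: derivative_eq_intros simp: power2_eq_square)
  have sub: "\<bar>g' \<theta>\<bar> * h (g \<theta>) = k \<theta> / 2 ^ m" if "\<theta> \<in> ?S" for \<theta>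
  proof -
    define S C where "S = sin \<theta>" and "C = cos \<theta>"
    have p: "S > 0" "C > 0" using sc[OF that] by (simp_all add: S_def C_def)
    have C2: "C\<^sup>2 = 1 - S\<^sup>2" by (simp add: S_def C_def cos_squared_eq)
    have gg: "g \<theta> * (1 + g \<theta>) = (C / (2 * S))\<^sup>2"
      using p C2 by (simp add: g_def S_def[symmetric] power_divide power_mult_distrib)
        (simp add: field_simps power2_eq_square)
    have "(g \<theta> * (1 + g \<theta>)) powr (real (Suc m) / 2 - 1) = (C / (2 * S)) powr (real m - 1)"
    proof -
      have e: "real (Suc m) / 2 - 1 = (real m - 1) / 2" by (simp add: field_simps)
      have "(c\<^sup>2) powr (x / 2) = c powr x" if "c > 0" for c x :: real
        using that by (simp add: powr_powr flip: powr_numeral)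
      then show ?thesis unfolding gg e using p by simp
    qed
    also have "\<dots> = C ^ m / (2 * S) ^ m * (2 * S / C)"
      using p by (simp add: powr_diff powr_realpow power_divide)
    finally have A: "(g \<theta> * (1 + g \<theta>)) powr (real (Suc m) / 2 - 1) = C ^ m / (2 * S) ^ m * (2 * S / C)" .
    have rg: "r * (1 + 2 * g \<theta>) = r / S"
      using p by (simp add: g_def divide_simps flip: S_def)
    have "of_real (r * (1 + 2 * g \<theta>)) - \<i> * of_real t = (of_real r - \<i> * of_real (t * S)) / of_real S"
      unfolding rg using p by (simp add: field_simps)
    then have "Re (1 / (of_real (r * (1 + 2 * g \<theta>)) - \<i> * of_real t) ^ Suc m) =
        Re (of_real (S ^ Suc m) * (1 / (of_real r - \<i> * of_real (t * S)) ^ Suc m))"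
      by (simp only: power_divide of_real_power) (simp del: power_Suc)
    also have "\<dots> = S ^ Suc m * Re (1 / (of_real r - \<i> * of_real (t * S)) ^ Suc m)"
      by (simp only: Re_complex_of_real Im_complex_of_real times_complex.sel mult_zero_left diff_0_right)
    finally have B: "Re (1 / (of_real (r * (1 + 2 * g \<theta>)) - \<i> * of_real t) ^ Suc m) =
        S ^ Suc m * Re (1 / (of_real r - \<i> * of_real (t * S)) ^ Suc m)" .
    have D: "\<bar>g' \<theta>\<bar> = C / (2 * S\<^sup>2)"
      using p by (simp add: g'_def S_def C_def)
    define X where "X = Re (1 / (of_real r - \<i> * of_real (t * S)) ^ Suc m)"
    have "\<bar>g' \<theta>\<bar> * h (g \<theta>) = C / (2 * S\<^sup>2) * (C ^ m / (2 * S) ^ m * (2 * S / C) * (S ^ Suc m * X))"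
      unfolding h_def A B D X_def ..
    also have "\<dots> = C ^ m * X / 2 ^ m"
      using p by (simp add: power_mult_distrib power2_eq_square)
    finally show ?thesis
      by (simp only: k_def X_def S_def C_def)
  qed
  have "of_real r - \<i> * of_real x \<noteq> 0" for x :: real
    using assms by (auto simp: complex_eq_iff)
  then have "continuous_on {0..pi/2} k"
    unfolding k_def by (intro continuous_intros) (auto simp del: power_Suc of_real_mult)
  then have "(\<lambda>\<theta>. k \<theta> / 2 ^ m) absolutely_integrable_on {0..pi/2}"
    by (intro absolutely_integrable_continuous_real continuous_intros) auto
  then have "(\<lambda>\<theta>. k \<theta> / 2 ^ m) absolutely_integrable_on ?S"
    by (rule set_integrable_subset) auto
  moreover have "(\<lambda>\<theta>. k \<theta> / 2 ^ m) absolutely_integrable_on ?S \<longleftrightarrow> (\<lambda>\<theta>. \<bar>g' \<theta>\<bar> * h (g \<theta>)) absolutely_integrable_on ?S"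
    unfolding set_integrable_def by (intro Bochner_Integration.integrable_cong) (auto simp: sub indicator_def)
  moreover have "integral ?S (\<lambda>\<theta>. \<bar>g' \<theta>\<bar> * h (g \<theta>)) = integral ?S (\<lambda>\<theta>. k \<theta> / 2 ^ m)"
    by (intro Henstock_Kurzweil_Integration.integral_cong sub)
  ultimately have "(\<lambda>\<theta>. \<bar>g' \<theta>\<bar> * h (g \<theta>)) absolutely_integrable_on ?S \<and>
      integral ?S (\<lambda>\<theta>. \<bar>g' \<theta>\<bar> * h (g \<theta>)) = integral {0..pi/2} k / 2 ^ m"
    by (simp add: integral_open_interval_real)
  then have H: "h absolutely_integrable_on {0<..}" "integral {0<..} h = integral {0..pi/2} k / 2 ^ m"
    using has_absolute_integral_change_of_variables_1' [OF _ der inj, of h] by (auto simp: img)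
  have meas: "set_borel_measurable borel {0<..} h"
    unfolding h_def set_borel_measurable_def by measurable
  then show "(LBINT s:{0<..}. h s) = integral {0..pi/2} k / 2 ^ m"
    using H by (simp add: LBINT_eq_HK)
  show "set_integrable lborel {0<..} h"
    using H(1) meas unfolding set_integrable_def set_borel_measurable_def
    by (subst (asm) integrable_completion) auto
qed

section \<open>Rotation invariance of the trigonometric integral\<close>

lemma rotation_denominator_nonzero:
  fixes \<phi> \<theta> :: real
  assumes "\<bar>\<phi>\<bar> < pi / 2"
  shows "cos (of_real \<phi>) - \<i> * sin (of_real \<phi>) * sin (of_real \<theta>) \<noteq> (0 :: complex)"
proof -
  have "cos \<phi> > 0"
    using assms by (intro cos_gt_zero_pi) auto
  moreover have "Re (cos (of_real \<phi>) - \<i> * sin (of_real \<phi>) * sin (of_real \<theta>)) = cos \<phi>"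
    by (simp add: cos_of_real sin_of_real)
  ultimately show ?thesis
    by (metis less_irrefl zero_complex.sel(1))
qed

lemma has_field_derivative_const_over_power:
  fixes c :: "'a :: real_normed_field"
  assumes "(g has_field_derivative g') (at x)" "g x \<noteq> 0"
  shows "((\<lambda>x. c / g x ^ Suc m) has_field_derivative
           of_nat (Suc m) * c * (- g') / g x ^ Suc (Suc m)) (at x)"
proof -
  have "((\<lambda>x. c / g x ^ Suc m) has_field_derivative
          - (c * (of_nat (Suc m) * g' * g x ^ m)) / (g x ^ Suc m * g x ^ Suc m)) (at x)"
    using assms by (auto intro!: derivative_eq_intros simp: mult_ac simp del: power_Suc)
  also have "- (c * (of_nat (Suc m) * g' * g x ^ m)) / (g x ^ Suc m * g x ^ Suc m) =
      of_nat (Suc m) * c * (- g') / g x ^ Suc (Suc m)"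
    using assms(2) by (simp add: divide_simps del: of_nat_Suc)
  finally show ?thesis .
qed

text \<open>
  The substitution \<open>sin \<theta> = tanh v\<close> explains the statement: it turns the left-hand side into the real
  part of \<open>\<integral> cosh (v - i\<phi>)\<^sup>-\<^sup>n dv\<close> over \<open>v > 0\<close>, with \<open>n = m + 1\<close>. Shifting the contour back to the
  real axis, inside the strip where \<open>cosh\<close> has no zero, costs only the segment from \<open>- i\<phi>\<close> to \<open>0\<close>,
  on which \<open>cosh\<close> is real and the differential imaginary, so that nothing is added to the real part.

  The proof uses the infinitesimal form of this shift in the compact variable \<open>\<theta>\<close>. With
  \<open>D = cos \<phi> - i sin \<phi> sin \<theta>\<close>, the \<open>\<phi>\<close>-derivative of \<open>cos\<^sup>m \<theta> / D\<^sup>n\<close> is the \<open>\<theta>\<close>-derivative of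
  \<open>G = - i (cos \<theta> / D)\<^sup>n\<close>. Now \<open>G\<close> vanishes at \<open>\<theta> = \<pi> / 2\<close> and is imaginary at \<open>\<theta> = 0\<close>, so the
  real part of the integral has derivative zero.
\<close>

lemma rotation_invariant_integral:
  fixes \<phi> :: real and m :: nat
  assumes "\<bar>\<phi>\<bar> < pi / 2"
  shows "Re (integral {0..pi/2} (\<lambda>\<theta>. of_real (cos \<theta> ^ m) /
             (of_real (cos \<phi>) - \<i> * of_real (sin \<phi> * sin \<theta>)) ^ Suc m)) =
         integral {0..pi/2} (\<lambda>\<theta>. cos \<theta> ^ m)"
proof -
  define U where "U = {- (pi/2)<..<pi/2}"
  define D where "D = (\<lambda>w t :: complex. cos w - \<i> * sin w * sin t)"
  define f where "f = (\<lambda>\<phi> \<theta>. cos (complex_of_real \<theta>) ^ m / D (of_real \<phi>) (of_real \<theta>) ^ Suc m)"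
  define fx where "fx = (\<lambda>\<phi> \<theta>. of_nat (Suc m) * cos (complex_of_real \<theta>) ^ m *
      (sin (of_real \<phi>) + \<i> * cos (of_real \<phi>) * sin (of_real \<theta>)) / D (of_real \<phi>) (of_real \<theta>) ^ Suc (Suc m))"
  have D0: "D (of_real \<phi>) (of_real \<theta>) \<noteq> 0" if "\<phi> \<in> U" for \<phi> \<theta> :: real
    unfolding D_def by (rule rotation_denominator_nonzero) (use that in \<open>auto simp: U_def\<close>)
  have derf: "((\<lambda>\<phi>. f \<phi> \<theta>) has_vector_derivative fx \<phi> \<theta>) (at \<phi> within U)" if "\<phi> \<in> U" for \<phi> \<theta>
  proof -
    have "((\<lambda>w. cos (complex_of_real \<theta>) ^ m / D w (of_real \<theta>) ^ Suc m) has_field_derivative fx \<phi> \<theta>)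
        (at (of_real \<phi>))"
    proof -
      have "((\<lambda>w. D w (of_real \<theta>)) has_field_derivative
              - (sin (of_real \<phi>) + \<i> * cos (of_real \<phi>) * sin (of_real \<theta>))) (at (of_real \<phi>))"
        unfolding D_def by (auto intro!: derivative_eq_intros simp: algebra_simps)
      from has_field_derivative_const_over_power[OF this D0[OF that]] show ?thesis
        unfolding fx_def minus_minus .
    qed
    from has_vector_derivative_real_field[OF this] show ?thesis
      unfolding f_def by (rule has_vector_derivative_at_within)
  qed
  have contf: "continuous_on {0..pi/2} (f \<phi>)" if "\<phi> \<in> U" for \<phi>
    unfolding f_def using D0[OF that] unfolding D_def by (intro continuous_intros) auto
  have contfx: "continuous_on (U \<times> {0..pi/2}) (\<lambda>(\<phi>, \<theta>). fx \<phi> \<theta>)"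
    unfolding fx_def case_prod_unfold using D0 unfolding D_def
    by (intro continuous_intros) (auto simp del: power_Suc)
  have intfx: "(fx \<phi> has_integral \<i> / of_real (cos \<phi>) ^ Suc m) {0..pi/2}" if "\<phi> \<in> U" for \<phi>
  proof -
    \<comment> \<open>The factor \<open>- \<i>\<close> is the Cauchy--Riemann one: in the variable \<open>v - \<i>\<phi>\<close> differentiation by
       \<open>\<phi>\<close> is \<open>- \<i>\<close> times differentiation by \<open>v\<close>, and \<open>dv = d\<theta> / cos \<theta>\<close>.\<close>
    define G where "G = (\<lambda>t. - \<i> * (cos t / D (of_real \<phi>) t) ^ Suc m)"
    have "((\<lambda>\<theta>. G (of_real \<theta>)) has_vector_derivative fx \<phi> \<theta>) (at \<theta> within {0..pi/2})" for \<theta> :: real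
    proof -
      let ?C = "cos (complex_of_real \<theta>)" and ?S = "sin (complex_of_real \<theta>)"
      let ?c = "cos (complex_of_real \<phi>)" and ?s = "sin (complex_of_real \<phi>)"
      let ?D = "D (of_real \<phi>) (of_real \<theta>)"
      have nz: "?D \<noteq> 0" using D0[OF that] .
      have "(G has_field_derivative - \<i> * (of_nat (Suc m) * (?C / ?D) ^ m *
               ((- ?S * ?D - ?C * (- \<i> * ?s * ?C)) / (?D * ?D)))) (at (of_real \<theta>))"
        unfolding G_def D_def using nz unfolding D_def
        by (auto intro!: derivative_eq_intros simp del: power_Suc)
      moreover have "- ?S * ?D - ?C * (- \<i> * ?s * ?C) = \<i> * (?s + \<i> * ?c * ?S)"
      proof -
        have "?C * ?C = 1 - ?S * ?S"
          using sin_cos_squared_add[of "complex_of_real \<theta>"] by (simp add: power2_eq_square algebra_simps)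
        moreover have "?C * (- \<i> * ?s * ?C) = - \<i> * ?s * (?C * ?C)"
          by (simp add: mult_ac)
        ultimately have CC: "?C * (- \<i> * ?s * ?C) = - \<i> * ?s * (1 - ?S * ?S)"
          by (simp only:)
        show ?thesis unfolding CC by (simp add: D_def algebra_simps)
      qed
      ultimately have "(G has_field_derivative fx \<phi> \<theta>) (at (of_real \<theta>))"
        by (simp add: fx_def power_divide mult_ac)
      from has_vector_derivative_real_field[OF this] show ?thesis
        by (rule has_vector_derivative_at_within)
    qed
    then have "(fx \<phi> has_integral (G (of_real (pi/2)) - G (of_real 0))) {0..pi/2}"
      by (intro fundamental_theorem_of_calculus) auto
    moreover have "G (of_real (pi/2)) = 0"
      by (simp add: G_def cos_of_real del: of_real_divide)
    moreover have "G (of_real 0) = - \<i> / of_real (cos \<phi>) ^ Suc m"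
      by (simp add: G_def D_def cos_of_real power_divide del: power_Suc)
    ultimately show ?thesis by simp
  qed
  define M where "M = (\<lambda>\<phi>. Re (integral {0..pi/2} (f \<phi>)))"
  have "(M has_field_derivative 0) (at \<phi> within U)" if \<phi>: "\<phi> \<in> U" for \<phi>
  proof -
    have "((\<lambda>\<phi>. integral (cbox 0 (pi/2)) (f \<phi>)) has_vector_derivative integral (cbox 0 (pi/2)) (fx \<phi>))
        (at \<phi> within U)"
      using derf contfx contf \<phi>
      by (intro leibniz_rule_vector_derivative) (auto simp: U_def intro: integrable_continuous_real)
    then have "(M has_vector_derivative Re (integral {0..pi/2} (fx \<phi>))) (at \<phi> within U)"
      unfolding M_def by (auto intro: bounded_linear.has_vector_derivative[OF bounded_linear_Re])
    moreover have "Re (integral {0..pi/2} (fx \<phi>)) = 0"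
    proof -
      have "integral {0..pi/2} (fx \<phi>) = \<i> * of_real (1 / cos \<phi> ^ Suc m)"
        using integral_unique[OF intfx[OF \<phi>]] by (simp del: power_Suc)
      then show ?thesis by (simp only: Re_i_times Im_complex_of_real minus_zero)
    qed
    ultimately show ?thesis
      by (simp add: has_real_derivative_iff_has_vector_derivative)
  qed
  then obtain c where c: "\<And>\<phi>. \<phi> \<in> U \<Longrightarrow> M \<phi> = c"
    using has_field_derivative_zero_constant[of U M] by (auto simp: U_def)
  have "M \<phi> = M 0"
    using c[of \<phi>] c[of 0] assms unfolding U_def abs_less_iff by simp
  moreover have "M 0 = integral {0..pi/2} (\<lambda>\<theta>. cos \<theta> ^ m)"
  proof -
    have "f 0 = complex_of_real \<circ> (\<lambda>\<theta>. cos \<theta> ^ m)"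
      by (auto simp: f_def D_def cos_of_real)
    moreover have "((complex_of_real \<circ> (\<lambda>\<theta>. cos \<theta> ^ m)) has_integral of_real (integral {0..pi/2} (\<lambda>\<theta>. cos \<theta> ^ m))) {0..pi/2}"
      by (intro has_integral_linear[OF _ bounded_linear_of_real] integrable_integral
            integrable_continuous_real continuous_intros)
    ultimately show ?thesis
      unfolding M_def by (metis integral_unique Re_complex_of_real)
  qed
  ultimately show ?thesis
    unfolding M_def f_def D_def by (simp add: cos_of_real sin_of_real mult.assoc del: power_Suc)
qed

lemma integral_polar_kernel:
  fixes r t :: real and m :: nat
  assumes "r > 0"
  shows "integral {0..pi/2} (\<lambda>\<theta>. cos \<theta> ^ m * Re (1 / (of_real r - \<i> * of_real (t * sin \<theta>)) ^ Suc m)) =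
         integral {0..pi/2} (\<lambda>\<theta>. cos \<theta> ^ m) / sqrt (r\<^sup>2 + t\<^sup>2) ^ Suc m"
proof -
  define \<rho> where "\<rho> = sqrt (r\<^sup>2 + t\<^sup>2)"
  define \<phi> where "\<phi> = arctan (t / r)"
  let ?K = "\<lambda>\<theta>. of_real (cos \<theta> ^ m) /
             (of_real (cos \<phi>) - \<i> * of_real (sin \<phi> * sin \<theta>)) ^ Suc m"
  have \<rho>: "\<rho> > 0" using assms by (simp add: \<rho>_def add_pos_nonneg)
  have "sqrt (1 + (t / r)\<^sup>2) = \<rho> / r"
  proof -
    have "1 + (t / r)\<^sup>2 = (r\<^sup>2 + t\<^sup>2) / r\<^sup>2"
      using assms by (simp add: power_divide field_simps)
    then show ?thesis using assms by (simp add: \<rho>_def real_sqrt_divide)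
  qed
  then have polar: "r = \<rho> * cos \<phi>" "t = \<rho> * sin \<phi>"
    using assms \<rho> by (simp_all add: \<phi>_def cos_arctan sin_arctan)
  have \<phi>: "\<bar>\<phi>\<bar> < pi/2"
    using arctan_bounded[of "t / r"] unfolding \<phi>_def abs_less_iff by linarith
  have eq: "cos \<theta> ^ m * Re (1 / (of_real r - \<i> * of_real (t * sin \<theta>)) ^ Suc m) = Re (?K \<theta>) / \<rho> ^ Suc m" for \<theta>
  proof -
    have "of_real r - \<i> * of_real (t * sin \<theta>) =
        of_real \<rho> * (of_real (cos \<phi>) - \<i> * of_real (sin \<phi> * sin \<theta>))"
      by (subst (1) polar(1), subst (1) polar(2)) (simp add: algebra_simps)
    then have "of_real (cos \<theta> ^ m) * (1 / (of_real r - \<i> * of_real (t * sin \<theta>)) ^ Suc m) =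
        ?K \<theta> / of_real (\<rho> ^ Suc m)"
      by (simp only: power_mult_distrib of_real_power) simp
    then have "Re (of_real (cos \<theta> ^ m) * (1 / (of_real r - \<i> * of_real (t * sin \<theta>)) ^ Suc m)) =
        Re (?K \<theta> / of_real (\<rho> ^ Suc m))" by (rule arg_cong)
    then show ?thesis
      by (simp only: Re_divide_of_real Re_complex_of_real Im_complex_of_real times_complex.sel mult_zero_left diff_0_right)
  qed
  have "of_real (cos \<phi>) - \<i> * of_real (sin \<phi> * sin \<theta>) \<noteq> 0" for \<theta>
    using rotation_denominator_nonzero[OF \<phi>, of \<theta>] by (simp add: cos_of_real sin_of_real mult.assoc)
  then have "continuous_on {0..pi/2} ?K"
    by (intro continuous_intros) (auto simp del: power_Suc of_real_mult)
  then have "?K integrable_on {0..pi/2}"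
    by (rule integrable_continuous_real)
  then have "integral {0..pi/2} (\<lambda>\<theta>. Re (?K \<theta>)) = Re (integral {0..pi/2} ?K)"
    using integral_linear[OF _ bounded_linear_Re] unfolding o_def by blast
  then show ?thesis
    unfolding eq by (simp only: Henstock_Kurzweil_Integration.integral_divide rotation_invariant_integral[OF \<phi>] \<rho>_def)
qed

section \<open>The Wallis integral and Gamma values\<close>

text \<open>
  The substitution \<open>t = sin\<^sup>2 \<theta>\<close> in the Beta integral.
\<close>

lemma integral_cos_power:
  "integral {0..pi/2} (\<lambda>\<theta>. cos \<theta> ^ m) = Beta (1/2) (real (Suc m) / 2) / 2"
proof -
  define a where "a = real (Suc m) / 2"
  define f where "f = (\<lambda>t::real. t powr (1/2 - 1) * (1 - t) powr (a - 1))"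
  define g where "g = (\<lambda>\<theta>::real. (sin \<theta>)\<^sup>2)"
  define g' where "g' = (\<lambda>\<theta>::real. 2 * sin \<theta> * cos \<theta>)"
  let ?S = "{0<..<pi/2::real}"
  have sc: "sin \<theta> > 0" "cos \<theta> > 0" if "\<theta> \<in> ?S" for \<theta> :: real
    using that by (auto intro!: sin_gt_zero cos_gt_zero)
  have img: "g ` ?S = {0<..<1}"
  proof (intro equalityI subsetI)
    fix y assume "y \<in> g ` ?S"
    then obtain \<theta> where t: "\<theta> \<in> ?S" "y = (sin \<theta>)\<^sup>2" by (auto simp: g_def)
    have "(cos \<theta>)\<^sup>2 > 0" "(sin \<theta>)\<^sup>2 > 0" using sc[OF t(1)] by auto
    then show "y \<in> {0<..<1}" using t(2) sin_cos_squared_add[of \<theta>] unfolding greaterThanLessThan_iff by linarith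
  next
    fix y :: real assume "y \<in> {0<..<1}"
    then have "arcsin (sqrt y) < arcsin 1" "arcsin 0 < arcsin (sqrt y)"
      by (subst arcsin_less_mono; auto)+
    moreover have "g (arcsin (sqrt y)) = y"
    proof -
      have "sin (arcsin (sqrt y)) = sqrt y"
        using \<open>y \<in> _\<close> by (intro sin_arcsin) (auto intro: order_trans[of _ 0])
      then show ?thesis using \<open>y \<in> _\<close> by (simp add: g_def)
    qed
    ultimately show "y \<in> g ` ?S" by (intro image_eqI[of _ _ "arcsin (sqrt y)"]) auto
  qed
  have inj: "inj_on g ?S"
  proof (rule inj_onI)
    fix x y assume xy: "x \<in> ?S" "y \<in> ?S" "g x = g y"
    then have "sin x = sin y"
      using sc[OF xy(1)] sc[OF xy(2)] by (simp add: g_def power2_eq_iff_nonneg)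
    then show "x = y" using xy sin_inj_pi[of x y] by auto
  qed
  have der: "(g has_field_derivative g' t) (at t within ?S)" if "t \<in> ?S" for t
    unfolding g_def g'_def by (auto intro!: derivative_eq_intros)
  have sub: "\<bar>g' \<theta>\<bar> * f (g \<theta>) = 2 * cos \<theta> ^ m" if "\<theta> \<in> ?S" for \<theta>
  proof -
    note p = sc[OF that]
    have "f (g \<theta>) = (sin \<theta>)\<^sup>2 powr (1/2 - 1) * (cos \<theta>)\<^sup>2 powr (a - 1)"
      by (simp add: f_def g_def cos_squared_eq)
    also have "(sin \<theta>)\<^sup>2 powr (1/2 - 1) = sin \<theta> powr (- 1)"
      using p by (simp add: powr_powr flip: powr_numeral)
    also have "(cos \<theta>)\<^sup>2 powr (a - 1) = cos \<theta> powr (real m - 1)"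
    proof -
      have "2 * (a - 1) = real m - 1" by (simp add: a_def)
      then show ?thesis using p by (simp add: powr_powr del: of_nat_Suc flip: powr_numeral)
    qed
    finally show ?thesis
      using p by (simp add: g'_def abs_mult powr_minus powr_diff powr_realpow)
  qed
  have f0: "f x \<ge> 0" for x by (simp add: f_def)
  have "(f has_integral Beta (1/2) a) {0<..<1}"
    using has_integral_Beta_real[of "1/2" a] by (simp add: f_def has_integral_Icc_iff_Ioo a_def)
  then have "f absolutely_integrable_on g ` ?S \<and> integral (g ` ?S) f = Beta (1/2) a"
    unfolding img using f0 by (auto intro!: nonnegative_absolutely_integrable_1 simp: integral_unique)
  then have "integral ?S (\<lambda>\<theta>. \<bar>g' \<theta>\<bar> * f (g \<theta>)) = Beta (1/2) a"
    using has_absolute_integral_change_of_variables_1' [OF _ der inj, of f "Beta (1/2) a"] by simp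
  also have "integral ?S (\<lambda>\<theta>. \<bar>g' \<theta>\<bar> * f (g \<theta>)) = integral ?S (\<lambda>\<theta>. 2 * cos \<theta> ^ m)"
    by (intro Henstock_Kurzweil_Integration.integral_cong sub)
  finally show ?thesis
    by (simp add: integral_open_interval_real a_def)
qed

lemma Gamma_duplication_real:
  fixes a :: real
  assumes "a > 0"
  shows "Gamma a * Gamma (a + 1/2) = 2 powr (1 - 2 * a) * sqrt pi * Gamma (2 * a)"
proof -
  have nz: "complex_of_real a \<notin> \<int>\<^sub>\<le>\<^sub>0" "complex_of_real a + 1/2 \<notin> \<int>\<^sub>\<le>\<^sub>0"
    using assms by (auto elim!: nonpos_Ints_cases simp: complex_eq_iff)
  have "complex_of_real (Gamma a * Gamma (a + 1/2)) = of_real (2 powr (1 - 2 * a) * sqrt pi * Gamma (2 * a))"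
    using Gamma_legendre_duplication[OF nz]
    by (simp add: Gamma_complex_of_real[symmetric] powr_def exp_of_real[symmetric])
  then show ?thesis by (simp only: of_real_eq_iff)
qed

text \<open>
  The Beta value contributes \<open>\<Gamma>(a) / \<Gamma>(a + 1/2)\<close> with \<open>2a = m + 1\<close>, while \<open>m! = \<Gamma>(2a)\<close> is by
  duplication a multiple of \<open>\<Gamma>(a) \<Gamma>(a + 1/2)\<close>: the unwanted Gamma value cancels.
\<close>

lemma Gamma_times_integral_cos_power:
  "fact m * integral {0..pi/2} (\<lambda>\<theta>. cos \<theta> ^ m) = 2 ^ m * (Gamma (real (Suc m) / 2))\<^sup>2 / 2"
proof -
  define a where "a = real (Suc m) / 2"
  have a: "a > 0" and m: "real (Suc m) = 2 * a" by (simp_all add: a_def)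
  have Beta: "Beta (1/2) a = sqrt pi * Gamma a / Gamma (a + 1/2)"
    by (simp add: Beta_def Gamma_one_half_real add.commute)
  have "fact m = Gamma (2 * a)"
    using Gamma_fact[of m, where 'a = real] by (simp add: m[symmetric])
  moreover have "2 powr (1 - 2 * a) * 2 ^ m = 1"
  proof -
    have "1 - 2 * a = - real m" using m by simp
    then show ?thesis by (simp add: powr_minus powr_realpow)
  qed
  moreover have "Gamma a > 0" "Gamma (a + 1/2) > 0" using a by (auto intro: Gamma_real_pos)
  moreover note Gamma_duplication_real[OF a]
  ultimately have "Gamma a * Gamma (a + 1/2) * 2 ^ m = sqrt pi * fact m"
    by (metis mult.assoc mult.commute mult.right_neutral)
  then have "fact m * (sqrt pi * Gamma a / Gamma (a + 1/2)) = 2 ^ m * (Gamma a)\<^sup>2"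
    using \<open>Gamma (a + 1/2) > 0\<close> by (simp add: field_simps power2_eq_square)
  then show ?thesis
    using Beta unfolding integral_cos_power a_def[symmetric] by simp
qed

section \<open>The integral representation\<close>

text \<open>
  Since \<open>|cos (t x)| \<le> 1\<close>, the case \<open>t = 0\<close> dominates all others. There the integrand is
  nonnegative, and its \<open>x\<close>-integral is an integrable function of \<open>s\<close> by \<open>tricomi_kernel_substitution\<close>.
\<close>

lemma tricomi_laplace_Fubini:
  fixes r t :: real and m :: nat
  assumes "r > 0"
  defines "W \<equiv> \<lambda>s. (s * (1 + s)) powr (real (Suc m) / 2 - 1)"
  shows "(LBINT x:{0<..}. LBINT s:{0<..}. W s * (x ^ m * exp (- (r * (1 + 2 * s) * x)) * cos (t * x))) =
         (LBINT s:{0<..}. LBINT x:{0<..}. W s * (x ^ m * exp (- (r * (1 + 2 * s) * x)) * cos (t * x)))"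
proof -
  define K where "K = (\<lambda>t s x. indicator {0<..} s * indicator {0<..} x *
      (W s * (x ^ m * exp (- (r * (1 + 2 * s) * x)) * cos (t * x :: real))))"
  have [measurable]: "case_prod (K t) \<in> borel_measurable (lborel \<Otimes>\<^sub>M lborel)" for t
    unfolding K_def W_def by measurable
  have Ki: "integrable lborel (K t s)"
    and KI: "(LINT x|lborel. K t s x) = indicator {0<..} s * (fact m *
         (W s * Re (1 / (of_real (r * (1 + 2 * s)) - \<i> * of_real t) ^ Suc m)))" for t s
  proof -
    have "integrable lborel (K t s) \<and> (LINT x|lborel. K t s x) = indicator {0<..} s * (fact m *
         (W s * Re (1 / (of_real (r * (1 + 2 * s)) - \<i> * of_real t) ^ Suc m)))"
    proof (cases "s > 0")
      case True
      then have b: "r * (1 + 2 * s) > 0" using assms by simp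
      have "K t s = (\<lambda>x. W s * (indicator {0<..} x *\<^sub>R (x ^ m * exp (- (r * (1 + 2 * s) * x)) * cos (t * x))))"
        using True by (auto simp: K_def)
      then show ?thesis
        using integral_power_times_exp_cos[OF b, of m t] True
        unfolding set_integrable_def set_lebesgue_integral_def by (simp del: power_Suc)
    qed (simp add: K_def)
    then show "integrable lborel (K t s)" "(LINT x|lborel. K t s x) = indicator {0<..} s * (fact m *
         (W s * Re (1 / (of_real (r * (1 + 2 * s)) - \<i> * of_real t) ^ Suc m)))"
      by blast+
  qed
  have "integrable (lborel \<Otimes>\<^sub>M lborel) (case_prod (K 0))"
  proof (rule lborel_pair.Fubini_integrable)
    have "norm (K 0 s x) = K 0 s x" for s x
      by (auto simp: K_def W_def indicator_def)
    moreover have "integrable lborel (\<lambda>s. fact m * (indicator {0<..} s *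
         (W s * Re (1 / (of_real (r * (1 + 2 * s)) - \<i> * of_real 0) ^ Suc m))))"
      using tricomi_kernel_substitution(1)[OF assms(1), of m 0]
      unfolding W_def set_integrable_def real_scaleR_def by (rule integrable_mult_right)
    ultimately show "integrable lborel (\<lambda>s. LINT x|lborel. norm (case_prod (K 0) (s, x)))"
      by (simp add: KI mult_ac del: power_Suc)
  qed (simp_all add: Ki)
  then have "integrable (lborel \<Otimes>\<^sub>M lborel) (case_prod (K t))"
  proof (rule Bochner_Integration.integrable_bound)
    show "AE p in lborel \<Otimes>\<^sub>M lborel. norm (case_prod (K t) p) \<le> norm (case_prod (K 0) p)"
      by (intro AE_I2) (auto simp: K_def W_def abs_mult indicator_def intro!: mult_left_le)
  qed simp
  from lborel_pair.Fubini_integral[OF this] show ?thesis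
    unfolding set_lebesgue_integral_def K_def
    by (simp add: mult_ac flip: integral_mult_right_zero) 
qed

theorem mainTheorem1:
  fixes z :: "complex ^ 'n" and \<tau> :: real
  assumes "z \<noteq> 0"
  shows "folland_G0 (z, \<tau>) =
    2 ^ (CARD('n) + 1) * Gamma (real CARD('n) / 2) / pi ^ (CARD('n) + 1) *
    (LBINT x:{0<..}. x ^ (CARD('n) - 1) * exp (- (x * (norm z)\<^sup>2)) *
       tricomi_Psi (real CARD('n) / 2) (real CARD('n)) (2 * x * (norm z)\<^sup>2) * cos (\<tau> * x))"
proof -
  obtain m where n: "CARD('n) = Suc m"
    using not0_implies_Suc[of "CARD('n)"] by auto
  define r where "r = (norm z)\<^sup>2"
  define a where "a = real (Suc m) / 2"
  define \<rho> where "\<rho> = sqrt (r\<^sup>2 + \<tau>\<^sup>2)"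
  define W where "W = (\<lambda>s. (s * (1 + s)) powr (a - 1))"
  let ?E = "\<lambda>x s. x ^ m * exp (- (r * (1 + 2 * s) * x)) * cos (\<tau> * x)"
  have r: "r > 0" using assms by (simp add: r_def)
  have \<rho>: "\<rho> > 0" using r by (simp add: \<rho>_def add_pos_nonneg)
  have G: "Gamma a > 0" by (simp add: a_def Gamma_real_pos)
  have "x ^ m * exp (- (x * r)) * tricomi_Psi a (Suc m) (2 * x * r) * cos (\<tau> * x) =
      (LBINT s:{0<..}. W s * ?E x s) / Gamma a" for x
  proof -
    have "x ^ m * exp (- (x * r)) * cos (\<tau> * x) *
           (LBINT s:{0<..}. exp (- (2 * x * r * s)) * s powr (a - 1) * (1 + s) powr (real (Suc m) - a - 1)) =
        (LBINT s:{0<..}. x ^ m * exp (- (x * r)) * cos (\<tau> * x) *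
            (exp (- (2 * x * r * s)) * s powr (a - 1) * (1 + s) powr (real (Suc m) - a - 1)))"
      by (rule set_integral_mult_right [symmetric])
    also have "\<dots> = (LBINT s:{0<..}. W s * ?E x s)"
    proof (rule set_lebesgue_integral_cong)
      have "exp (- (r * (1 + 2 * s) * x)) = exp (- (x * r)) * exp (- (2 * x * r * s))" for s
        by (simp add: algebra_simps flip: exp_add)
      moreover have "W s = s powr (a - 1) * (1 + s) powr (real (Suc m) - a - 1)" if "s > 0" for s
      proof -
        \<comment> \<open>Both powers in the integral of \<open>\<Psi>\<close> have the same exponent because \<open>c = 2a\<close>.\<close>
        have "real (Suc m) - a - 1 = a - 1" by (simp add: a_def field_simps)
        with that show ?thesis by (simp only: W_def) (simp add: powr_mult)
      qed
      ultimately show "\<forall>s. s \<in> {0<..} \<longrightarrow> x ^ m * exp (- (x * r)) * cos (\<tau> * x) *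
            (exp (- (2 * x * r * s)) * s powr (a - 1) * (1 + s) powr (real (Suc m) - a - 1)) = W s * ?E x s"
        by simp
    qed simp
    finally show ?thesis by (simp add: tricomi_Psi_def mult_ac)
  qed
  then have "(LBINT x:{0<..}. x ^ m * exp (- (x * r)) * tricomi_Psi a (Suc m) (2 * x * r) * cos (\<tau> * x)) =
      (LBINT x:{0<..}. LBINT s:{0<..}. W s * ?E x s) / Gamma a"
    by (simp only: set_integral_divide_zero)
  also have "(LBINT x:{0<..}. LBINT s:{0<..}. W s * ?E x s) = (LBINT s:{0<..}. LBINT x:{0<..}. W s * ?E x s)"
    unfolding W_def a_def by (rule tricomi_laplace_Fubini[OF r])
  also have "\<dots> = (LBINT s:{0<..}. fact m *
      (W s * Re (1 / (of_real (r * (1 + 2 * s)) - \<i> * of_real \<tau>) ^ Suc m)))"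
    by (rule set_lebesgue_integral_cong)
       (use r in \<open>auto simp: integral_power_times_exp_cos(2) simp del: power_Suc of_real_mult\<close>)
  also have "\<dots> = fact m * (integral {0..pi/2} (\<lambda>\<theta>. cos \<theta> ^ m) / \<rho> ^ Suc m / 2 ^ m)"
    unfolding W_def a_def \<rho>_def set_integral_mult_right
      tricomi_kernel_substitution(2)[OF r] integral_polar_kernel[OF r] ..
  also have "\<dots> = (fact m * integral {0..pi/2} (\<lambda>\<theta>. cos \<theta> ^ m)) / 2 ^ m / \<rho> ^ Suc m"
    by simp
  also have "\<dots> = (Gamma a)\<^sup>2 / 2 / \<rho> ^ Suc m"
    unfolding Gamma_times_integral_cos_power a_def by simp
  finally have I: "(LBINT x:{0<..}. x ^ m * exp (- (x * r)) * tricomi_Psi a (Suc m) (2 * x * r) * cos (\<tau> * x)) =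
      Gamma a / 2 / \<rho> ^ Suc m"
    using G by (simp add: power2_eq_square)
  have a2: "2 * - a = - real (Suc m)"
    by (simp only: a_def mult_minus_right nonzero_mult_div_cancel_left times_divide_eq_right
        zero_neq_numeral not_False_eq_True)
  have "(norm z ^ 4 + \<tau>\<^sup>2) powr (- a) = (\<rho>\<^sup>2) powr (- a)"
    by (simp add: \<rho>_def r_def)
  also have "\<dots> = \<rho> powr (2 * - a)"
    using \<rho> by (simp add: powr_powr flip: powr_numeral)
  also have "\<dots> = 1 / \<rho> ^ Suc m"
    using \<rho> by (simp only: a2 powr_minus powr_realpow) (simp add: inverse_eq_divide)
  finally show ?thesis
    using I G unfolding folland_G0_def folland_const_def n r_def a_def
    by (simp add: power2_eq_square mult_ac)
qed

end
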